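(* Let $X$ be any compact metric space (not necessarily ultrametric) and let $p\in[1,+\infty)$. Then $$\operatorname{crit}_{\mathscr{P}}\mathscr{W}_p(X)\ \ge\ \dim X,$$ where $\dim X$ is the Hausdorff dimension of $X$.
   Context: For a compact metric space $X$ and $p\in[1,+\infty)$, $\mathscr{W}_p(X)=(\mathcal{P}(X),\mathrm{W}_p)$ is the set of Borel probability measures on $X$ endowed with the distance $$\mathrm{W}_p(\mu,\nu)=\left(\inf_{\Pi\in\Gamma(\mu,\nu)}\int_{X\times X}d(a,b)^p\,\Pi(\mathrm{d}a\,\mathrm{d}b)\right)^{1/p},$$ where $\Gamma(\mu,\nu)$ is the set of Borel probability measures on $X\times X$ with marginals $\mu$ and $\nu$. The power-exponential critical parameter $\operatorname{crit}_{\mathscr{P}}Z\in[0,+\infty]$ of a metric space $Z$ is defined as the Hausdorff dimension, with $\varepsilon^s$ replaced by $\exp(-\varepsilon^{-s})$: for $s>0$ put $f_s(r)=\exp(-1/r^s)$ for $r>0$ and $f_s(0)=0$, and $$\mathcal{H}^{s}(Z)=\lim_{\delta\to0}\ \inf\Big\{\sum_i f_s(\operatorname{diam}E_i)\ :\ (E_i)\text{ a countable cover of }Z\text{ with }\operatorname{diam}E_i\le\delta\ \forall i\Big\}.$$ Then $\operatorname{crit}_{\mathscr{P}}Z=\sup\{s>0:\mathcal{H}^s(Z)>0\}$, with $\sup\emptyset=0$. *)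

theory Defs
  imports "HOL-Probability.Probability"
begin

section \<open>Hausdorff-type dimensions of a metric space\<close>

text \<open>Metric spaces are given by a carrier set and a distance function on it, because
  the Wasserstein spaces below are not types. The diameter takes values in \<open>[0, \<infinity>]\<close>,
  and the diameter of the empty set is 0.\<close>

definition ediam :: "('a \<Rightarrow> 'a \<Rightarrow> real) \<Rightarrow> 'a set \<Rightarrow> ennreal" where
  "ediam d E = (SUP (x, y) \<in> E \<times> E. ennreal (d x y))"

text \<open>Countable covers are sequences of subsets of the carrier. Finite covers are
  included by padding with empty sets, which contribute nothing since the gauges used below
  vanish at 0. Members of a cover have finite diameter, so that \<open>enn2real\<close> below loses nothing.
  If there is no cover, the infimum is \<open>\<infinity>\<close>.\<close>

definition delta_covers :: "'a set \<Rightarrow> ('a \<Rightarrow> 'a \<Rightarrow> real) \<Rightarrow> real \<Rightarrow> (nat \<Rightarrow> 'a set) set" where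
  "delta_covers Z d \<delta> =
     {E. (\<forall>i. E i \<subseteq> Z \<and> ediam d (E i) \<le> ennreal \<delta>) \<and> Z \<subseteq> (\<Union>i. E i)}"

definition gauge_content ::
    "(real \<Rightarrow> real) \<Rightarrow> 'a set \<Rightarrow> ('a \<Rightarrow> 'a \<Rightarrow> real) \<Rightarrow> real \<Rightarrow> ennreal" where
  "gauge_content f Z d \<delta> =
     (INF E \<in> delta_covers Z d \<delta>. \<Sum>i. ennreal (f (enn2real (ediam d (E i)))))"

definition gauge_measure ::
    "(real \<Rightarrow> real) \<Rightarrow> 'a set \<Rightarrow> ('a \<Rightarrow> 'a \<Rightarrow> real) \<Rightarrow> ennreal" where
  "gauge_measure f Z d = Lim (at_right 0) (gauge_content f Z d)"

text \<open>The limit exists, the content being monotone in \<open>\<delta>\<close>.\<close>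

lemma gauge_content_antimono:
  assumes "\<delta> \<le> \<delta>'"
  shows "gauge_content f Z d \<delta>' \<le> gauge_content f Z d \<delta>"
proof -
  have "delta_covers Z d \<delta> \<subseteq> delta_covers Z d \<delta>'"
    using assms by (auto simp: delta_covers_def intro: order_trans ennreal_leI)
  then show ?thesis
    unfolding gauge_content_def by (rule INF_superset_mono) simp
qed

lemma gauge_content_tendsto_SUP:
  "(gauge_content f Z d \<longlongrightarrow> (SUP \<delta>\<in>{0<..}. gauge_content f Z d \<delta>)) (at_right 0)"
proof (rule increasing_tendsto)
  show "\<forall>\<^sub>F \<delta> in at_right 0. gauge_content f Z d \<delta> \<le> (SUP \<delta>\<in>{0<..}. gauge_content f Z d \<delta>)"
    by (auto simp: eventually_at_filter intro!: always_eventually SUP_upper)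
next
  fix x assume "x < (SUP \<delta>\<in>{0<..}. gauge_content f Z d \<delta>)"
  then obtain \<delta> where "\<delta> > 0" and x: "x < gauge_content f Z d \<delta>"
    by (auto simp: less_SUP_iff)
  have "\<forall>\<^sub>F r in at_right 0. r < \<delta>"
    using \<open>\<delta> > 0\<close> by (auto simp: eventually_at_right)
  then show "\<forall>\<^sub>F r in at_right 0. x < gauge_content f Z d r"
    by eventually_elim (meson x gauge_content_antimono less_imp_le order_less_le_trans)
qed

lemma gauge_measure_eq_SUP:
  "gauge_measure f Z d = (SUP \<delta>\<in>{0<..}. gauge_content f Z d \<delta>)"
  unfolding gauge_measure_def
  by (rule tendsto_Lim[OF _ gauge_content_tendsto_SUP]) simp

text \<open>In \<^typ>\<open>ennreal\<close> the supremum of the empty set is 0.\<close>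

definition crit_param ::
    "(real \<Rightarrow> real \<Rightarrow> real) \<Rightarrow> 'a set \<Rightarrow> ('a \<Rightarrow> 'a \<Rightarrow> real) \<Rightarrow> ennreal" where
  "crit_param F Z d = Sup {ennreal s | s. s > 0 \<and> gauge_measure (F s) Z d > 0}"

definition power_gauge :: "real \<Rightarrow> real \<Rightarrow> real" where
  "power_gauge s r = r powr s"

definition pow_exp_gauge :: "real \<Rightarrow> real \<Rightarrow> real" where
  "pow_exp_gauge s r = (if r = 0 then 0 else exp (- (1 / r powr s)))"

definition hausdorff_dim :: "'a set \<Rightarrow> ('a \<Rightarrow> 'a \<Rightarrow> real) \<Rightarrow> ennreal" where
  "hausdorff_dim = crit_param power_gauge"

definition crit_pow_exp :: "'a set \<Rightarrow> ('a \<Rightarrow> 'a \<Rightarrow> real) \<Rightarrow> ennreal" where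
  "crit_pow_exp = crit_param pow_exp_gauge"

section \<open>Wasserstein spaces\<close>

text \<open>Borel probability measures on a subspace \<open>X\<close>: their underlying space is \<open>X\<close> itself
  and their sigma-algebra is the trace on \<open>X\<close> of the ambient Borel sets, that is, the Borel
  sigma-algebra of the subspace topology.\<close>

definition borel_probs :: "'a::topological_space set \<Rightarrow> 'a measure set" where
  "borel_probs X = {\<mu>. prob_space \<mu> \<and> sets \<mu> = sets (restrict_space borel X)}"

definition couplings ::
    "'a::topological_space set \<Rightarrow> 'a measure \<Rightarrow> 'a measure \<Rightarrow> ('a \<times> 'a) measure set" where
  "couplings X \<mu> \<nu> = {\<gamma> \<in> borel_probs (X \<times> X).
     distr \<gamma> (restrict_space borel X) fst = \<mu> \<and> distr \<gamma> (restrict_space borel X) snd = \<nu>}"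

text \<open>The infimum is taken in \<open>[0, \<infinity>]\<close>; it is finite when \<open>X\<close> is compact.\<close>

definition wasserstein_dist ::
    "real \<Rightarrow> 'a::metric_space set \<Rightarrow> 'a measure \<Rightarrow> 'a measure \<Rightarrow> real" where
  "wasserstein_dist p X \<mu> \<nu> =
     enn2real (INF \<gamma> \<in> couplings X \<mu> \<nu>. \<integral>\<^sup>+ (a, b). ennreal (dist a b powr p) \<partial>\<gamma>) powr (1 / p)"

end

theory Submission
  imports Defs
begin

text \<open>If \<open>s < dim X\<close>, then for every small \<open>\<epsilon>\<close> the space \<open>X\<close> contains at least a constant times
  \<open>\<epsilon> powr - s\<close> points that are \<open>\<epsilon>\<close>-separated. Group them into \<open>N\<close> pairs; choosing one point in each
  pair and averaging the \<open>N\<close> Dirac masses gives \<open>2 ^ N\<close> measures, two of which are at Wasserstein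
  distance at least \<open>\<epsilon> / N\<close> times the number of pairs on which the choices differ. Do this for a
  geometric sequence of scales \<open>\<epsilon> k\<close> and mix the levels with weights \<open>2 powr - (k + 1)\<close>: when all
  choices at the other levels are kept, a set of measures of diameter at most
  \<open>2 powr - (k + 1) * \<epsilon> k / 8\<close> contains only a proportion \<open>exp (- N k / 10)\<close> of the choices at level
  \<open>k\<close>, by a Chernoff bound. For \<open>t < s\<close> and a suitable ratio of the scales this is at most
  \<open>exp (- r powr - t)\<close> for a set of diameter \<open>r\<close>, so a union bound on the compact space of all choices
  bounds \<open>\<Sum>i. exp (- r i powr - t)\<close> from below for every cover. Only the box-counting dimension
  matters at each single scale, so no Frostman measure is needed.\<close>

section \<open>Counting in products of finite sets\<close>

lemma sum_Pow_power_card: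
  fixes z :: "'b::comm_semiring_1"
  assumes "finite A"
  shows "(\<Sum>c\<in>Pow A. z ^ card c) = (1 + z) ^ card A"
  using assms
proof (induction A rule: finite_induct)
  case (insert a A)
  have inj: "inj_on (insert a) (Pow A)"
    using insert.hyps by (auto simp: inj_on_def)
  have disj: "Pow A \<inter> insert a ` Pow A = {}"
    using insert.hyps by auto
  have "(\<Sum>c\<in>Pow (insert a A). z ^ card c)
      = (\<Sum>c\<in>Pow A. z ^ card c) + (\<Sum>c\<in>Pow A. z ^ card (insert a c))"
    using insert.hyps by (simp add: Pow_insert sum.union_disjoint[OF _ _ disj] sum.reindex[OF inj])
  also have "(\<Sum>c\<in>Pow A. z ^ card (insert a c)) = (\<Sum>c\<in>Pow A. z * z ^ card c)"
    using insert.hyps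
    by (intro sum.cong refl) (subst card_insert_disjoint, auto intro: finite_subset)
  finally show ?case
    using insert by (simp add: sum_distrib_left[symmetric] algebra_simps)
qed simp

text \<open>The count is compared with \<open>(\<Sum>c\<in>Pow {..<N}. (1/4) ^ card c) = (5/4) ^ N\<close>.\<close>

lemma card_small_subsets_le:
  "real (card {c \<in> Pow {..<N}. 4 * card c \<le> N}) \<le> exp (- real N / 10) * 2 ^ N"
proof -
  let ?C = "{c \<in> Pow {..<N}. 4 * card c \<le> N}"
  \<comment> \<open>Here \<open>w ^ 4 = 1 / 4\<close>, so \<open>w ^ N\<close> plays the role of 1/4
    to the power N/4 and can be compared with \<open>(1 / 4) ^ card c\<close> when
    \<open>4 * card c \<le> N\<close>.\<close>
  define w where "w = sqrt (1 / 2)"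
  have w: "0 < w" "w \<le> 1" and w2: "w ^ 2 = 1 / 2"
    by (simp_all add: w_def)
  have w4: "w ^ 4 = 1 / 4"
    using power_mult[of w 2 2] w2 by (simp add: power_one_over power2_eq_square[of "1 / 2 :: real"])
  have "real (card ?C) * w ^ N = (\<Sum>c\<in>?C. w ^ N)"
    by simp
  also have "\<dots> \<le> (\<Sum>c\<in>?C. w ^ (4 * card c))"
    using w by (intro sum_mono power_decreasing) auto
  also have "\<dots> = (\<Sum>c\<in>?C. (1 / 4) ^ card c)"
    by (simp add: power_mult w4)
  also have "\<dots> \<le> (\<Sum>c\<in>Pow {..<N}. (1 / 4 :: real) ^ card c)"
    by (intro sum_mono2) auto
  also have "\<dots> = (5 / 4) ^ N"
    by (simp add: sum_Pow_power_card)
  finally have "real (card ?C) \<le> (5 / 4) ^ N / w ^ N"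
    using w by (simp add: field_simps)
  also have "\<dots> = (5 / 4 / w) ^ N"
    by (simp add: power_divide)
  also have "\<dots> \<le> (exp (- 1 / 10) * 2) ^ N"
  proof (intro power_mono)
    \<comment> \<open>25/36 is a rational just below sqrt(1/2), chosen so that 5/4 divided by it is
      exactly 9/5.\<close>
    have "25 / 36 \<le> w"
      unfolding w_def by (rule real_le_rsqrt) (simp add: power2_eq_square)
    then have "5 / 4 / w \<le> 9 / 10 * 2"
      using w by (simp add: field_simps)
    also have "9 / 10 \<le> exp (- 1 / 10 :: real)"
      using exp_ge_add_one_self[of "- 1 / 10 :: real"] by simp
    finally show "5 / 4 / w \<le> exp (- 1 / 10) * 2"
      by simp
  qed (use w in simp)
  also have "\<dots> = exp (- real N / 10) * 2 ^ N"
    by (simp add: power_mult_distrib exp_of_nat_mult[symmetric])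
  finally show ?thesis .
qed

text \<open>By Tychonoff, a product of finite discrete spaces is compact. Membership in
  \<open>U i\<close> is decided by the first \<open>K i\<close> coordinates, so its trace on the
  product is open.\<close>

lemma finite_subcover_cylinders:
  fixes B :: "nat \<Rightarrow> 'b set" and U :: "'i \<Rightarrow> (nat \<Rightarrow> 'b) set"
  assumes fin: "\<And>k. finite (B k)"
    and cover: "(\<Pi>\<^sub>E k\<in>UNIV. B k) \<subseteq> (\<Union>i. U i)"
    and cyl: "\<And>i w w'. w \<in> U i \<Longrightarrow> \<forall>j<K i. w j = w' j \<Longrightarrow> w' \<in> U i"
  obtains F where "finite F" "(\<Pi>\<^sub>E k\<in>UNIV. B k) \<subseteq> (\<Union>i\<in>F. U i)"
proof -
  let ?T = "product_topology (\<lambda>k. discrete_topology (B k)) UNIV"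
  let ?\<Omega> = "\<Pi>\<^sub>E k\<in>UNIV. B k"
  have comp: "compactin ?T (topspace ?T)"
    unfolding compact_space_def[symmetric]
    by (simp add: compact_space_product_topology compact_space_discrete_topology fin)
  have opn: "openin ?T V" if "V \<in> range (\<lambda>i. U i \<inter> ?\<Omega>)" for V
  proof -
    have "openin ?T (U i \<inter> ?\<Omega>)" for i
      unfolding openin_product_topology_alt
    proof
      fix w assume w: "w \<in> U i \<inter> ?\<Omega>"
      define V where "V j = (if j < K i then {w j} else B j)" for j
      have "{j \<in> UNIV. V j \<noteq> topspace (discrete_topology (B j))} \<subseteq> {..<K i}"
        by (auto simp: V_def split: if_splits)
      then have "finite {j \<in> UNIV. V j \<noteq> topspace (discrete_topology (B j))}"
        by (rule finite_subset) simp
      moreover have "\<forall>j\<in>UNIV. openin (discrete_topology (B j)) (V j)"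
        using w by (auto simp: V_def)
      moreover have "w \<in> Pi\<^sub>E UNIV V"
        using w by (auto simp: V_def PiE_iff)
      moreover have "Pi\<^sub>E UNIV V \<subseteq> U i \<inter> ?\<Omega>"
      proof
        fix w' assume w': "w' \<in> Pi\<^sub>E UNIV V"
        have V: "w' j \<in> V j" for j
          using w' by auto
        have "\<forall>j<K i. w j = w' j"
          using V by (metis V_def singletonD)
        moreover have "V j \<subseteq> B j" for j
          using w by (auto simp: V_def)
        ultimately show "w' \<in> U i \<inter> ?\<Omega>"
          using V w cyl by (auto simp: PiE_iff)
      qed
      ultimately show "\<exists>V. finite {j \<in> UNIV. V j \<noteq> topspace (discrete_topology (B j))} \<and>
          (\<forall>j\<in>UNIV. openin (discrete_topology (B j)) (V j)) \<and> w \<in> Pi\<^sub>E UNIV V \<and>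
          Pi\<^sub>E UNIV V \<subseteq> U i \<inter> ?\<Omega>"
        by blast
    qed
    with that show ?thesis
      by blast
  qed
  have cov: "topspace ?T \<subseteq> \<Union> (range (\<lambda>i. U i \<inter> ?\<Omega>))"
    using cover by auto
  from compactinD[OF comp opn cov] obtain \<F> where \<F>: "finite \<F>" "\<F> \<subseteq> range (\<lambda>i. U i \<inter> ?\<Omega>)" "topspace ?T \<subseteq> \<Union>\<F>"
    by blast
  then obtain F where "finite F" "\<F> = (\<lambda>i. U i \<inter> ?\<Omega>) ` F"
    by (meson finite_subset_image)
  with \<F>(3) show ?thesis
    by (intro that[of F]) auto
qed

text \<open>Counting form of a union bound in the infinite product \<open>\<Pi>\<^sub>E k\<in>UNIV. B k\<close>: a cylinder which,
  for every choice of the other coordinates, contains at most a proportion \<open>q\<close> of the possible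
  values of one coordinate has probability at most \<open>q\<close>.\<close>

lemma cylinder_cover_weight_ge_1:
  fixes B :: "nat \<Rightarrow> 'b set" and U :: "'i \<Rightarrow> (nat \<Rightarrow> 'b) set"
  assumes fin: "\<And>k. finite (B k)" and ne: "\<And>k. B k \<noteq> {}"
    and cover: "(\<Pi>\<^sub>E k\<in>UNIV. B k) \<subseteq> (\<Union>i. U i)"
    and cyl: "\<And>i w w'. w \<in> U i \<Longrightarrow> \<forall>j<K i. w j = w' j \<Longrightarrow> w' \<in> U i"
    and q: "\<And>i w. w \<in> (\<Pi>\<^sub>E k\<in>UNIV. B k) \<Longrightarrow>
      real (card {b \<in> B (k i). w(k i := b) \<in> U i}) \<le> q i * real (card (B (k i)))"
  obtains F where "finite F" "1 \<le> (\<Sum>i\<in>F. q i)"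
proof -
  obtain F where F: "finite F" "(\<Pi>\<^sub>E k\<in>UNIV. B k) \<subseteq> (\<Union>i\<in>F. U i)"
    by (rule finite_subcover_cylinders[of B U K]) (rule fin, rule cover, erule cyl, assumption, rule that, assumption+)
  define b0 where "b0 k = (SOME b. b \<in> B k)" for k
  have b0: "b0 k \<in> B k" for k
    unfolding b0_def using ne[of k] by (simp add: some_in_eq)
  \<comment> \<open>Only the counted coordinates \<open>k i\<close> have to lie below
    \<open>n\<close>. A set \<open>U i\<close> may also look at later ones; \<open>ext\<close>
    freezes these at \<open>b0\<close>, so the count takes place in a finite box.\<close>
  define n where "n = Suc (Max (k ` F))"
  have k_less: "k i < n" if "i \<in> F" for i
    using F(1) that by (simp add: n_def less_Suc_eq_le)
  define ext where "ext v j = (if j < n then v j else b0 j)" for v :: "nat \<Rightarrow> 'b" and j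
  have ext_upd: "ext (v(j := b)) = (ext v)(j := b)" if "j < n" for v j b
    using that by (auto simp: ext_def)
  let ?\<Omega> = "\<Pi>\<^sub>E j\<in>{..<n}. B j"
  define V where "V i = {v \<in> ?\<Omega>. ext v \<in> U i}" for i
  have finV: "finite (V i)" for i
    unfolding V_def using fin by (intro finite_subset[OF _ finite_PiE[of "{..<n}" B]]) auto
  have card_V: "real (card (V i)) \<le> q i * real (card ?\<Omega>)" if i: "i \<in> F" for i
  proof -
    let ?R = "\<Pi>\<^sub>E j\<in>{..<n} - {k i}. B j"
    let ?S = "\<lambda>v. {b \<in> B (k i). (ext v)(k i := b) \<in> U i}"
    have finR: "finite ?R"
      using fin by (intro finite_PiE) auto
    have n_eq: "{..<n} = insert (k i) ({..<n} - {k i})"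
      using k_less[OF i] by auto
    \<comment> \<open>The box is sliced along coordinate \<open>k i\<close>; assumption
      \<open>q\<close> bounds each slice.\<close>
    have "V i \<subseteq> (\<Union>v\<in>?R. (\<lambda>b. v(k i := b)) ` ?S v)"
    proof
      fix v assume v: "v \<in> V i"
      then have "v \<in> Pi\<^sub>E (insert (k i) ({..<n} - {k i})) B"
        using n_eq by (simp add: V_def)
      then obtain b g where bg: "b \<in> B (k i)" "g \<in> ?R" "v = g(k i := b)"
        unfolding PiE_insert_eq by auto
      then have "b \<in> ?S g"
        using v k_less[OF i] by (simp add: V_def ext_upd)
      then show "v \<in> (\<Union>v\<in>?R. (\<lambda>b. v(k i := b)) ` ?S v)"
        using bg by blast
    qed
    then have "card (V i) \<le> card (\<Union>v\<in>?R. (\<lambda>b. v(k i := b)) ` ?S v)"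
      using finR fin by (intro card_mono finite_UN_I) auto
    also have "\<dots> \<le> (\<Sum>v\<in>?R. card ((\<lambda>b. v(k i := b)) ` ?S v))"
      by (rule card_UN_le[OF finR])
    also have "\<dots> \<le> (\<Sum>v\<in>?R. card (?S v))"
      using fin by (intro sum_mono card_image_le) auto
    finally have "real (card (V i)) \<le> (\<Sum>v\<in>?R. real (card (?S v)))"
      by (simp flip: of_nat_sum)
    also have "\<dots> \<le> (\<Sum>v\<in>?R. q i * real (card (B (k i))))"
    proof (intro sum_mono)
      fix v assume v: "v \<in> ?R"
      \<comment> \<open>Functions in \<open>?R\<close> are \<open>undefined\<close> at
        \<open>k i\<close>. Filling in \<open>b0\<close> gives a point of the product, as
        \<open>q\<close> requires, and the update at \<open>k i\<close> erases the filling.\<close>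
      define v' where "v' = v(k i := b0 (k i))"
      have "(ext v)(k i := b) = (ext v')(k i := b)" for b
        using k_less[OF i] by (simp add: v'_def ext_upd)
      moreover have "ext v' \<in> (\<Pi>\<^sub>E k\<in>UNIV. B k)"
        using v b0 k_less[OF i] by (auto simp: ext_def v'_def PiE_iff)
      ultimately show "real (card (?S v)) \<le> q i * real (card (B (k i)))"
        using q by simp
    qed
    also have "\<dots> = q i * (real (card ?R) * real (card (B (k i))))"
      by simp
    also have "real (card ?R) * real (card (B (k i))) = real (card ?\<Omega>)"
      using k_less[OF i] by (simp add: card_PiE prod.remove[of "{..<n}" "k i"] mult.commute)
    finally show ?thesis .
  qed
  have "?\<Omega> \<subseteq> (\<Union>i\<in>F. V i)"
  proof
    fix v assume v: "v \<in> ?\<Omega>"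
    then have "ext v \<in> (\<Pi>\<^sub>E k\<in>UNIV. B k)"
      using b0 by (auto simp: ext_def PiE_iff)
    then show "v \<in> (\<Union>i\<in>F. V i)"
      using F(2) v by (auto simp: V_def)
  qed
  then have "card ?\<Omega> \<le> card (\<Union>i\<in>F. V i)"
    using F(1) finV by (intro card_mono) auto
  also have "\<dots> \<le> (\<Sum>i\<in>F. card (V i))"
    by (rule card_UN_le[OF F(1)])
  finally have "real (card ?\<Omega>) \<le> (\<Sum>i\<in>F. real (card (V i)))"
    by (simp flip: of_nat_sum)
  also have "\<dots> \<le> (\<Sum>i\<in>F. q i) * real (card ?\<Omega>)"
    unfolding sum_distrib_right by (intro sum_mono card_V)
  finally have "1 * real (card ?\<Omega>) \<le> (\<Sum>i\<in>F. q i) * real (card ?\<Omega>)"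
    by simp
  moreover have "0 < real (card ?\<Omega>)"
    using fin ne by (simp add: card_PiE prod_pos card_gt_0_iff)
  ultimately have "1 \<le> (\<Sum>i\<in>F. q i)"
    by (rule mult_right_le_imp_le)
  with F(1) show ?thesis
    by (rule that)
qed

section \<open>Lower bounds for the Wasserstein distance\<close>

text \<open>A convex function lies above its tangent at \<open>L\<close>. The point 0 is checked
  directly, because convexity is used on the open half-line.\<close>

lemma powr_ge_tangent:
  fixes x L p :: real
  assumes "1 \<le> p" "0 \<le> x" "0 < L"
  shows "L powr p + p * L powr (p - 1) * (x - L) \<le> x powr p"
proof (cases "x = 0")
  case True
  then show ?thesis
    using assms by (simp add: powr_mult_base[of L "p - 1"] algebra_simps)
next
  case False
  have "x powr p - L powr p \<ge> p * L powr (p - 1) * (x - L)"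
  proof (rule convex_on_imp_above_tangent[where A = "{0<..}"])
    show "convex_on {0<..} (\<lambda>x. x powr p)"
      using assms by (intro powr_convex)
    show "((\<lambda>x. x powr p) has_field_derivative p * L powr (p - 1)) (at L within {0<..})"
      using assms by (auto intro!: derivative_eq_intros)
  qed (use assms False in \<open>auto simp: interior_open\<close>)
  then show ?thesis
    by simp
qed

text \<open>Jensen's inequality, by integrating the tangent at \<open>L\<close>. Its slope is
  nonnegative, so a lower bound \<open>L\<close> of the mean suffices, and the right side may be
  infinite.\<close>

lemma (in prob_space) powr_le_nn_integral_powr:
  fixes f :: "'a \<Rightarrow> real"
  assumes "1 \<le> p" "0 \<le> L" and f: "integrable M f" "\<And>x. x \<in> space M \<Longrightarrow> 0 \<le> f x" "L \<le> expectation f"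
  shows "ennreal (L powr p) \<le> (\<integral>\<^sup>+x. ennreal (f x powr p) \<partial>M)"
proof (cases "L = 0")
  case False
  define g where "g x = L powr p + p * L powr (p - 1) * (f x - L)" for x
  have int: "integrable M g"
    unfolding g_def using f(1) by simp
  have "L powr p \<le> L powr p + p * L powr (p - 1) * (expectation f - L)"
    using assms by simp
  also have "\<dots> = expectation g"
    unfolding g_def using f(1) by (simp add: prob_space)
  finally have "ennreal (L powr p) \<le> ennreal (expectation g)"
    by (rule ennreal_leI)
  also have "\<dots> \<le> (\<integral>\<^sup>+x. ennreal (g x) \<partial>M)"
  proof -
    \<comment> \<open>The tangent can be negative, where \<open>ennreal\<close> truncates it to 0;
      hence the passage through the positive part.\<close>
    have "ennreal (expectation g) \<le> ennreal (expectation (\<lambda>x. max 0 (g x)))"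
      using int by (intro ennreal_leI integral_mono) auto
    also have "\<dots> = (\<integral>\<^sup>+x. ennreal (max 0 (g x)) \<partial>M)"
      using int by (intro nn_integral_eq_integral[symmetric]) auto
    also have "\<dots> = (\<integral>\<^sup>+x. ennreal (g x) \<partial>M)"
      by (intro nn_integral_cong) (simp add: max_def ennreal_neg)
    finally show ?thesis .
  qed
  also have "\<dots> \<le> (\<integral>\<^sup>+x. ennreal (f x powr p) \<partial>M)"
    using assms False by (intro nn_integral_mono ennreal_leI) (auto simp: g_def intro!: powr_ge_tangent)
  finally show ?thesis .
qed (use assms in simp)

lemma lipschitz_borel_measurable:
  fixes f :: "'a::metric_space \<Rightarrow> real"
  assumes "\<And>a b. \<bar>f a - f b\<bar> \<le> dist a b"
  shows "f \<in> borel_measurable (restrict_space borel X)"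
proof -
  have "1-lipschitz_on UNIV f"
    using assms by (intro lipschitz_onI) (auto simp: dist_real_def)
  then have "continuous_on UNIV f"
    by (rule lipschitz_on_continuous_on)
  then show ?thesis
    by (intro measurable_restrict_space1 borel_measurable_continuous_onI)
qed

text \<open>The easy half of Kantorovich duality: under any coupling, the two means of
  \<open>f\<close> differ by at most the mean distance, which Jensen compares with the
  \<open>p\<close>-th moment.\<close>

lemma wasserstein_dist_ge:
  fixes X :: "'a::metric_space set" and f :: "'a \<Rightarrow> real"
  assumes "bounded X" "1 \<le> p" "\<gamma>\<^sub>0 \<in> couplings X \<mu> \<nu>"
    and lip: "\<And>x y. \<bar>f x - f y\<bar> \<le> dist x y"
  shows "\<bar>(\<integral>x. f x \<partial>\<mu>) - (\<integral>x. f x \<partial>\<nu>)\<bar> \<le> wasserstein_dist p X \<mu> \<nu>"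
proof -
  define L where "L = \<bar>(\<integral>x. f x \<partial>\<mu>) - (\<integral>x. f x \<partial>\<nu>)\<bar>"
  obtain D where D: "0 \<le> D" "\<And>x y. x \<in> X \<Longrightarrow> y \<in> X \<Longrightarrow> dist x y \<le> D"
    using \<open>bounded X\<close> by (metis bounded_two_points dist_self linorder_linear)
  let ?I = "\<lambda>\<gamma>. \<integral>\<^sup>+ (a, b). ennreal (dist a b powr p) \<partial>\<gamma>"
  have f_meas: "f \<in> borel_measurable (restrict_space borel X)"
    using lip by (rule lipschitz_borel_measurable)
  have lower: "ennreal (L powr p) \<le> ?I \<gamma>" if \<gamma>: "\<gamma> \<in> couplings X \<mu> \<nu>" for \<gamma>
  proof -
    have sets_\<gamma>: "sets \<gamma> = sets (restrict_space borel (X \<times> X))" and "prob_space \<gamma>"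
      and \<mu>: "\<mu> = distr \<gamma> (restrict_space borel X) fst"
      and \<nu>: "\<nu> = distr \<gamma> (restrict_space borel X) snd"
      using \<gamma> by (auto simp: couplings_def borel_probs_def)
    interpret prob_space \<gamma> by fact
    have space_\<gamma>: "space \<gamma> = X \<times> X"
      using sets_eq_imp_space_eq[OF sets_\<gamma>] by (simp add: space_restrict_space)
    have fst_meas: "fst \<in> measurable \<gamma> (restrict_space borel X)"
      and snd_meas: "snd \<in> measurable \<gamma> (restrict_space borel X)"
      unfolding measurable_cong_sets[OF sets_\<gamma> refl]
      by (intro measurable_restrict_space3 borel_measurable_continuous_onI continuous_intros; auto)+
    have dist_meas: "(\<lambda>z. dist (fst z) (snd z)) \<in> borel_measurable \<gamma>"
      unfolding measurable_cong_sets[OF sets_\<gamma> refl]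
      by (intro measurable_restrict_space1 borel_measurable_continuous_onI continuous_intros)
    have dist_int: "integrable \<gamma> (\<lambda>z. dist (fst z) (snd z))"
      using D space_\<gamma> dist_meas by (intro integrable_const_bound[where B = D]) auto
    have "integrable \<gamma> (\<lambda>z. f (fst z))" "integrable \<gamma> (\<lambda>z. f (snd z))"
    proof -
      obtain z where z: "z \<in> X \<times> X"
        using not_empty space_\<gamma> by auto
      have bound: "\<bar>f x\<bar> \<le> \<bar>f (fst z)\<bar> + D" if "x \<in> X" for x
        using lip[of x "fst z"] D(2)[OF that, of "fst z"] z by auto
      show "integrable \<gamma> (\<lambda>z. f (fst z))" "integrable \<gamma> (\<lambda>z. f (snd z))"
        using bound space_\<gamma> measurable_compose[OF fst_meas f_meas] measurable_compose[OF snd_meas f_meas]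
        by (auto intro!: integrable_const_bound[where B = "\<bar>f (fst z)\<bar> + D"])
    qed
    note f_int = this
    have "L = \<bar>\<integral>z. f (fst z) - f (snd z) \<partial>\<gamma>\<bar>"
      using f_int by (simp add: L_def \<mu> \<nu> integral_distr[OF fst_meas f_meas] integral_distr[OF snd_meas f_meas])
    also have "\<dots> \<le> (\<integral>z. \<bar>f (fst z) - f (snd z)\<bar> \<partial>\<gamma>)"
      by (rule integral_abs_bound)
    also have "\<dots> \<le> (\<integral>z. dist (fst z) (snd z) \<partial>\<gamma>)"
      using f_int dist_int lip by (intro integral_mono) auto
    finally have "ennreal (L powr p) \<le> (\<integral>\<^sup>+z. ennreal (dist (fst z) (snd z) powr p) \<partial>\<gamma>)"
      using \<open>1 \<le> p\<close> dist_int by (intro powr_le_nn_integral_powr) (auto simp: L_def)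
    then show ?thesis
      by (simp add: case_prod_unfold)
  qed
  \<comment> \<open>\<open>enn2real\<close> would send an infinite infimum to 0; the coupling
    \<open>\<gamma>\<^sub>0\<close> excludes this.\<close>
  have "?I \<gamma>\<^sub>0 < \<infinity>"
  proof -
    have "prob_space \<gamma>\<^sub>0" "sets \<gamma>\<^sub>0 = sets (restrict_space borel (X \<times> X))"
      using assms(3) by (auto simp: couplings_def borel_probs_def)
    then interpret prob_space \<gamma>\<^sub>0 by simp
    have "space \<gamma>\<^sub>0 = X \<times> X"
      using sets_eq_imp_space_eq[OF \<open>sets \<gamma>\<^sub>0 = _\<close>] by (simp add: space_restrict_space)
    then have "?I \<gamma>\<^sub>0 \<le> (\<integral>\<^sup>+z. ennreal (D powr p) \<partial>\<gamma>\<^sub>0)"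
      using D \<open>1 \<le> p\<close> by (intro nn_integral_mono) (auto intro!: ennreal_leI powr_mono2)
    also have "\<dots> < \<infinity>"
      by (simp add: emeasure_space_1)
    finally show ?thesis .
  qed
  then have "(INF \<gamma>\<in>couplings X \<mu> \<nu>. ?I \<gamma>) < \<infinity>"
    using assms(3) by (meson INF_lower le_less_trans)
  moreover have "ennreal (L powr p) \<le> (INF \<gamma>\<in>couplings X \<mu> \<nu>. ?I \<gamma>)"
    by (intro INF_greatest lower)
  ultimately have "enn2real (ennreal (L powr p)) \<le> enn2real (INF \<gamma>\<in>couplings X \<mu> \<nu>. ?I \<gamma>)"
    by (intro enn2real_mono) auto
  then have "(L powr p) powr (1 / p) \<le> wasserstein_dist p X \<mu> \<nu>"
    unfolding wasserstein_dist_def using \<open>1 \<le> p\<close> by (intro powr_mono2) auto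
  moreover have "0 \<le> L"
    by (simp add: L_def)
  ultimately show ?thesis
    using \<open>1 \<le> p\<close> by (simp add: powr_powr L_def)
qed

section \<open>Separated points\<close>

lemma ediam_leI:
  assumes "\<And>x y. x \<in> E \<Longrightarrow> y \<in> E \<Longrightarrow> d x y \<le> r"
  shows "ediam d E \<le> ennreal r"
  unfolding ediam_def using assms by (auto intro!: SUP_least ennreal_leI)

text \<open>Take a largest separated subset \<open>S\<close> of a finite
  \<open>\<epsilon>\<close>-net \<open>C\<close>; it exists because \<open>C\<close> is finite. By
  maximality each point of \<open>C\<close> is within \<open>\<epsilon>\<close> of \<open>S\<close>,
  hence the radius \<open>2 * \<epsilon>\<close>.\<close>

lemma compact_separated_net:
  fixes X :: "'a::metric_space set"
  assumes "compact X" "0 < \<epsilon>"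
  obtains S where "finite S" "S \<subseteq> X" "X \<subseteq> (\<Union>x\<in>S. ball x (2 * \<epsilon>))"
    "\<And>x y. x \<in> S \<Longrightarrow> y \<in> S \<Longrightarrow> x \<noteq> y \<Longrightarrow> \<epsilon> \<le> dist x y"
proof -
  obtain C where C: "finite C" "C \<subseteq> X" "X \<subseteq> (\<Union>x\<in>C. ball x \<epsilon>)"
    using seq_compact_imp_totally_bounded[OF assms(1)[unfolded compact_eq_seq_compact_metric],
        rule_format, OF assms(2)] by (elim exE conjE)
  define sep where "sep S \<longleftrightarrow> S \<subseteq> C \<and> (\<forall>x\<in>S. \<forall>y\<in>S. x \<noteq> y \<longrightarrow> \<epsilon> \<le> dist x y)" for S
  have "sep {}"
    by (simp add: sep_def)
  moreover have "\<forall>S. sep S \<longrightarrow> card S < Suc (card C)"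
    using C(1) by (auto simp: sep_def less_Suc_eq_le intro: card_mono)
  ultimately have "\<exists>S. sep S \<and> (\<forall>T. sep T \<longrightarrow> card T \<le> card S)"
    by (rule ex_has_greatest_nat)
  then obtain S where S: "sep S" "\<And>T. sep T \<Longrightarrow> card T \<le> card S"
    by blast
  have finS: "finite S"
    using S(1) C(1) by (auto simp: sep_def intro: finite_subset)
  have near: "\<exists>y\<in>S. dist x y < \<epsilon>" if "x \<in> C" for x
  proof (rule ccontr)
    assume *: "\<not> (\<exists>y\<in>S. dist x y < \<epsilon>)"
    then have "sep (insert x S)"
      using S(1) that by (auto simp: sep_def dist_commute not_less)
    moreover have "x \<notin> S"
      using * \<open>0 < \<epsilon>\<close> by force
    ultimately show False
      using S(2)[of "insert x S"] finS by simp
  qed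
  have "X \<subseteq> (\<Union>x\<in>S. ball x (2 * \<epsilon>))"
  proof
    fix z assume "z \<in> X"
    then obtain x where "x \<in> C" and zx: "dist x z < \<epsilon>"
      using C(3) by auto
    then obtain y where y: "y \<in> S" "dist x y < \<epsilon>"
      using near by blast
    then have "dist y z < 2 * \<epsilon>"
      using zx dist_triangle[of y z x] by (simp add: dist_commute)
    then show "z \<in> (\<Union>x\<in>S. ball x (2 * \<epsilon>))"
      using y by auto
  qed
  then show ?thesis
    using finS S(1) C(2) by (intro that[of S]) (auto simp: sep_def)
qed

text \<open>The balls have diameter at most \<open>4 * \<epsilon>\<close>; padded by empty sets, of
  gauge 0, they form an admissible cover.\<close>

lemma net_card_ge_content:
  fixes X :: "'a::metric_space set"
  assumes "0 < s" "0 < \<epsilon>" "finite S" "X \<subseteq> (\<Union>x\<in>S. ball x (2 * \<epsilon>))"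
  shows "gauge_content (power_gauge s) X dist (4 * \<epsilon>) \<le> ennreal (real (card S) * (4 * \<epsilon>) powr s)"
proof -
  obtain e where e: "bij_betw e {..<card S} S"
    using ex_bij_betw_nat_finite[OF assms(3)] by (auto simp: atLeast0LessThan)
  define E where "E i = (if i < card S then X \<inter> ball (e i) (2 * \<epsilon>) else {})" for i
  have diam: "ediam dist (E i) \<le> ennreal (4 * \<epsilon>)" for i
  proof (rule ediam_leI)
    fix x y assume "x \<in> E i" "y \<in> E i"
    then have "dist (e i) x < 2 * \<epsilon>" "dist (e i) y < 2 * \<epsilon>"
      by (auto simp: E_def split: if_splits)
    then show "dist x y \<le> 4 * \<epsilon>"
      using dist_triangle[of x y "e i"] by (simp add: dist_commute)
  qed
  have "X \<subseteq> (\<Union>i. E i)"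
  proof
    fix x assume x: "x \<in> X"
    then obtain y where "y \<in> S" "x \<in> ball y (2 * \<epsilon>)"
      using assms(4) by auto
    moreover from \<open>y \<in> S\<close> e obtain i where "i < card S" "e i = y"
      unfolding bij_betw_def by (metis imageE lessThan_iff)
    ultimately show "x \<in> (\<Union>i. E i)"
      using x by (auto simp: E_def intro!: exI[of _ i])
  qed
  then have "E \<in> delta_covers X dist (4 * \<epsilon>)"
    using diam by (auto simp: delta_covers_def E_def)
  then have "gauge_content (power_gauge s) X dist (4 * \<epsilon>)
      \<le> (\<Sum>i. ennreal (power_gauge s (enn2real (ediam dist (E i)))))"
    unfolding gauge_content_def by (rule INF_lower)
  also have "\<dots> = (\<Sum>i<card S. ennreal (power_gauge s (enn2real (ediam dist (E i)))))"
    using assms(1) by (intro suminf_finite) (auto simp: E_def ediam_def power_gauge_def)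
  also have "\<dots> \<le> (\<Sum>i<card S. ennreal ((4 * \<epsilon>) powr s))"
  proof (intro sum_mono ennreal_leI)
    fix i
    have "enn2real (ediam dist (E i)) \<le> 4 * \<epsilon>"
      using enn2real_mono[OF diam] assms(2) by simp
    then show "power_gauge s (enn2real (ediam dist (E i))) \<le> (4 * \<epsilon>) powr s"
      unfolding power_gauge_def using assms(1) by (intro powr_mono2) auto
  qed
  also have "\<dots> = ennreal (real (card S) * (4 * \<epsilon>) powr s)"
    by (simp add: ennreal_mult ennreal_of_nat_eq_real_of_nat)
  finally show ?thesis .
qed

text \<open>A positive content at one scale bounds the content at all smaller scales from below, and
  so forces every fine net to be large. Its points are then grouped in twos.\<close>

lemma separated_pairs_of_gauge_measure_pos:
  fixes X :: "'a::metric_space set"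
  assumes "compact X" "0 < s" "0 < gauge_measure (power_gauge s) X dist"
  obtains c \<epsilon>\<^sub>0 :: real where "0 < c" "0 < \<epsilon>\<^sub>0"
    "\<And>\<epsilon>. 0 < \<epsilon> \<Longrightarrow> \<epsilon> \<le> \<epsilon>\<^sub>0 \<Longrightarrow> \<exists>N (x :: nat \<Rightarrow> bool \<Rightarrow> 'a). 0 < N \<and> c * \<epsilon> powr - s \<le> real N \<and>
      (\<forall>j b. x j b \<in> X) \<and>
      (\<forall>j<N. \<forall>j'<N. \<forall>b b'. (j, b) \<noteq> (j', b') \<longrightarrow> \<epsilon> \<le> dist (x j b) (x j' b'))"
proof -
  obtain \<delta> where \<delta>: "0 < \<delta>" "0 < gauge_content (power_gauge s) X dist \<delta>"
    using assms(3) by (auto simp: gauge_measure_eq_SUP less_SUP_iff)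
  \<comment> \<open>The content may be infinite; the minimum with 1 makes \<open>h\<close> a
    positive real.\<close>
  define h where "h = enn2real (min 1 (gauge_content (power_gauge s) X dist \<delta>))"
  have fin: "min 1 (gauge_content (power_gauge s) X dist \<delta>) < \<top>"
    by (simp add: min_less_iff_disj)
  have h: "0 < h"
    using \<delta>(2) fin by (simp add: h_def enn2real_positive_iff)
  have h_le: "ennreal h \<le> gauge_content (power_gauge s) X dist \<delta>"
    using fin by (simp add: h_def)
  \<comment> \<open>\<open>4 powr - s\<close> comes from the diameter \<open>4 * \<epsilon>\<close>,
    and the last 4 from \<open>n div 2 \<ge> n / 4\<close>.\<close>
  define c where "c = h * 4 powr - s / 4"
  \<comment> \<open>The first bound gives \<open>4 * \<epsilon> \<le> \<delta>\<close>; the second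
    forces \<open>2 \<le> n\<close>, so that there is at least one pair.\<close>
  define \<epsilon>\<^sub>0 where "\<epsilon>\<^sub>0 = min \<delta> ((h / 2) powr (1 / s)) / 4"
  have pairs: "\<exists>N (x :: nat \<Rightarrow> bool \<Rightarrow> 'a). 0 < N \<and> c * \<epsilon> powr - s \<le> real N \<and>
      (\<forall>j b. x j b \<in> X) \<and>
      (\<forall>j<N. \<forall>j'<N. \<forall>b b'. (j, b) \<noteq> (j', b') \<longrightarrow> \<epsilon> \<le> dist (x j b) (x j' b'))"
    if \<epsilon>: "0 < \<epsilon>" "\<epsilon> \<le> \<epsilon>\<^sub>0" for \<epsilon>
  proof -
    obtain S where S: "finite S" "S \<subseteq> X" "X \<subseteq> (\<Union>x\<in>S. ball x (2 * \<epsilon>))"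
      "\<And>x y. x \<in> S \<Longrightarrow> y \<in> S \<Longrightarrow> x \<noteq> y \<Longrightarrow> \<epsilon> \<le> dist x y"
      using compact_separated_net[OF assms(1) \<epsilon>(1)] by blast
    define n where "n = card S"
    have "4 * \<epsilon> \<le> \<delta>" "4 * \<epsilon> \<le> (h / 2) powr (1 / s)"
      using \<epsilon> by (auto simp: \<epsilon>\<^sub>0_def)
    note h_le
    also have "gauge_content (power_gauge s) X dist \<delta> \<le> gauge_content (power_gauge s) X dist (4 * \<epsilon>)"
      by (rule gauge_content_antimono) fact
    also have "\<dots> \<le> ennreal (real n * (4 * \<epsilon>) powr s)"
      unfolding n_def using assms(2) \<epsilon>(1) S(1,3) by (rule net_card_ge_content)
    finally have h_n: "h \<le> real n * (4 * \<epsilon>) powr s"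
      by (simp add: ennreal_le_iff)
    have "(4 * \<epsilon>) powr s \<le> ((h / 2) powr (1 / s)) powr s"
      using \<epsilon> assms(2) \<open>4 * \<epsilon> \<le> (h / 2) powr (1 / s)\<close> by (intro powr_mono2) auto
    also have "\<dots> = h / 2"
      using assms(2) h by (simp add: powr_powr)
    finally have "real n * (4 * \<epsilon>) powr s \<le> real n * (h / 2)"
      by (rule mult_left_mono) simp
    with h_n have "h \<le> real n * (h / 2)"
      by (rule order_trans)
    then have "h * 2 \<le> h * real n"
      by (simp add: mult.commute)
    then have n: "2 \<le> n"
      using h by simp
    obtain e where e: "bij_betw e {..<n} S"
      using ex_bij_betw_nat_finite[OF S(1)] by (auto simp: atLeast0LessThan n_def)
    \<comment> \<open>Pair \<open>j\<close> consists of the indices \<open>2 * j\<close> and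
      \<open>2 * j + 1\<close>. The default 0 keeps all points in \<open>X\<close>, even for
      \<open>j\<close> beyond the last pair.\<close>
    define ix where "ix j b = (if 2 * j + of_bool b < n then 2 * j + of_bool b else 0)" for j :: nat and b
    have ix_less: "ix j b < n" for j b
      using n by (simp add: ix_def)
    have ix_inj: "ix j b \<noteq> ix j' b'" if "j < n div 2" "j' < n div 2" "(j, b) \<noteq> (j', b')" for j j' b b'
    proof -
      have "ix i c = 2 * i + of_bool c" if "i < n div 2" for i c
      proof -
        have "2 * i + 1 < n"
          using that by linarith
        then show ?thesis
          by (cases c) (simp_all add: ix_def)
      qed
      then show ?thesis
        using that by (cases b; cases b') (simp_all, presburger+)
    qed
    have "c * \<epsilon> powr - s \<le> real (n div 2)"
    proof -
      have "c * \<epsilon> powr - s = h * (4 * \<epsilon>) powr - s / 4"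
        using \<epsilon>(1) by (simp add: c_def powr_mult)
      also have "h * (4 * \<epsilon>) powr - s \<le> real n"
        using h_n \<epsilon>(1) by (simp add: powr_minus field_simps)
      also have "real n / 4 \<le> real (n div 2)"
        using n by linarith
      finally show ?thesis
        by simp
    qed
    moreover have "\<forall>j b. e (ix j b) \<in> X"
      using ix_less e S(2) by (auto simp: bij_betw_def)
    moreover have "\<epsilon> \<le> dist (e (ix j b)) (e (ix j' b'))"
      if "j < n div 2" "j' < n div 2" "(j, b) \<noteq> (j', b')" for j j' b b'
    proof (rule S(4))
      show "e (ix j b) \<noteq> e (ix j' b')"
        using e ix_less ix_inj[OF that] by (auto simp: bij_betw_def inj_on_def)
    qed (use e ix_less in \<open>auto simp: bij_betw_def\<close>)
    ultimately show ?thesis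
      using n by (intro exI[of _ "n div 2"] exI[of _ "\<lambda>j b. e (ix j b)"]) auto
  qed
  have "0 < c" "0 < \<epsilon>\<^sub>0"
    using h \<delta>(1) by (auto simp: c_def \<epsilon>\<^sub>0_def)
  from this pairs show ?thesis
    by (rule that)
qed

section \<open>Measures with random atoms at all scales\<close>

text \<open>\<open>geometric_pmf (1 / 2)\<close> gives level \<open>k\<close> the weight
  \<open>(1 / 2) ^ Suc k\<close>. The law lives on the indices and does not depend on the choices,
  so all measures to be compared are images of one law.\<close>

definition level_pmf :: "(nat \<Rightarrow> nat) \<Rightarrow> (nat \<times> nat) pmf" where
  "level_pmf N = bind_pmf (geometric_pmf (1 / 2)) (\<lambda>k. map_pmf (Pair k) (pmf_of_set {..<N k}))"

lemma set_level_pmf: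
  assumes "\<And>k. 0 < N k"
  shows "set_pmf (level_pmf N) = {(k, j). j < N k}"
proof -
  have "finite {..<N k}" "{..<N k} \<noteq> {}" for k
    using assms[of k] by auto
  then show ?thesis
    by (auto simp: level_pmf_def set_pmf_geometric set_pmf_of_set)
qed

lemma pmf_level_pmf:
  assumes "\<And>k. 0 < N k" "j < N k"
  shows "pmf (level_pmf N) (k, j) = (1 / 2) ^ Suc k / real (N k)"
proof -
  have N: "finite {..<N k}" "{..<N k} \<noteq> {}" for k
    using assms(1)[of k] by auto
  have "pmf (level_pmf N) (k, j)
      = (\<integral>l. pmf (map_pmf (Pair l) (pmf_of_set {..<N l})) (k, j) \<partial>geometric_pmf (1 / 2))"
    by (simp add: level_pmf_def pmf_bind)
  also have "\<dots> = (\<Sum>l\<in>{k}. pmf (map_pmf (Pair l) (pmf_of_set {..<N l})) (k, j) * pmf (geometric_pmf (1 / 2)) l)"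
    by (rule integral_measure_pmf_real) (auto simp: pmf_eq_0_set_pmf)
  finally show ?thesis
    using assms(2) N by (simp add: pmf_map_inj' inj_on_def)
qed

text \<open>The tail events decrease to the empty set, so high levels can be neglected at any
  prescribed cost.\<close>

lemma level_pmf_tail:
  assumes "0 < \<eta>"
  obtains K where "measure_pmf.prob (level_pmf N) {z. K \<le> fst z} < \<eta>"
proof -
  have "(\<lambda>K. measure_pmf.prob (level_pmf N) {z. K \<le> fst z}) \<longlonglongrightarrow>
      measure_pmf.prob (level_pmf N) (\<Inter>K. {z. K \<le> fst z})"
    by (rule measure_pmf.finite_Lim_measure_decseq) (auto simp: decseq_def)
  moreover have "(\<Inter>K. {z :: nat \<times> nat. K \<le> fst z}) = {}"
    using Suc_n_not_le_n by blast
  ultimately have "(\<lambda>K. measure_pmf.prob (level_pmf N) {z. K \<le> fst z}) \<longlonglongrightarrow> 0"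
    by simp
  then have "\<forall>\<^sub>F K in sequentially. measure_pmf.prob (level_pmf N) {z. K \<le> fst z} < \<eta>"
    using assms by (rule order_tendstoD)
  then show ?thesis
    using that by (auto dest: eventually_happens)
qed

text \<open>At each level \<open>k\<close>, a configuration \<open>w k \<subseteq> {..<N k}\<close> stands for choosing \<open>x k j True\<close> when
  \<open>j \<in> w k\<close> and \<open>x k j False\<close> otherwise.\<close>

locale separated_levels =
  fixes X :: "'a::metric_space set" and p :: real
    and N :: "nat \<Rightarrow> nat" and x :: "nat \<Rightarrow> nat \<Rightarrow> bool \<Rightarrow> 'a" and \<epsilon> :: "nat \<Rightarrow> real"
  assumes bounded_X: "bounded X" and p_ge_1: "1 \<le> p" and N_pos: "\<And>k. 0 < N k"
    and x_in: "\<And>k j b. x k j b \<in> X" and eps_pos: "\<And>k. 0 < \<epsilon> k"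
    and sep: "\<And>k j j' b b'. j < N k \<Longrightarrow> j' < N k \<Longrightarrow> (j, b) \<noteq> (j', b') \<Longrightarrow> \<epsilon> k \<le> dist (x k j b) (x k j' b')"
begin

definition sel :: "(nat \<Rightarrow> nat set) \<Rightarrow> nat \<times> nat \<Rightarrow> 'a" where
  "sel w z = x (fst z) (snd z) (snd z \<in> w (fst z))"

definition config_measure :: "(nat \<Rightarrow> nat set) \<Rightarrow> 'a measure" where
  "config_measure w = distr (measure_pmf (level_pmf N)) (restrict_space borel X) (sel w)"

lemma sel_in: "sel w z \<in> X"
  by (simp add: sel_def x_in)

lemma sel_measurable: "sel w \<in> measurable (measure_pmf (level_pmf N)) (restrict_space borel X)"
  by (auto simp: measurable_def space_restrict_space sel_in)

lemma config_measure_in: "config_measure w \<in> borel_probs X"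
  unfolding borel_probs_def config_measure_def
  by (auto intro!: measure_pmf.prob_space_distr sel_measurable)

text \<open>Drawing one index and reading it in both configurations couples the two measures. This
  provides the coupling that keeps the infimum in the distance finite.\<close>

lemma coupling_config_measures:
  "distr (measure_pmf (level_pmf N)) (restrict_space borel (X \<times> X)) (\<lambda>z. (sel w z, sel w' z))
     \<in> couplings X (config_measure w) (config_measure w')"
proof -
  let ?B = "restrict_space borel (X \<times> X)"
  have pair: "(\<lambda>z. (sel w z, sel w' z)) \<in> measurable (measure_pmf (level_pmf N)) ?B"
    by (auto simp: measurable_def space_restrict_space sel_in)
  have proj: "fst \<in> measurable ?B (restrict_space borel X)" "snd \<in> measurable ?B (restrict_space borel X)"
    by (intro measurable_restrict_space3 borel_measurable_continuous_onI continuous_intros; auto)+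
  show ?thesis
    using pair proj
    by (auto simp: couplings_def borel_probs_def config_measure_def distr_distr comp_def
        intro!: measure_pmf.prob_space_distr)
qed

lemma integrable_sel:
  fixes f :: "'a \<Rightarrow> real"
  assumes "\<And>a b. \<bar>f a - f b\<bar> \<le> dist a b"
  shows "integrable (measure_pmf (level_pmf N)) (\<lambda>z. f (sel w z))"
proof -
  obtain B where B: "\<And>y. y \<in> X \<Longrightarrow> dist (x 0 0 True) y \<le> B"
    using bounded_X bounded_any_center[of X "x 0 0 True"] by auto
  have "\<bar>f (sel w z)\<bar> \<le> \<bar>f (x 0 0 True)\<bar> + B" for z
    using assms[of "x 0 0 True" "sel w z"] B[OF sel_in, of w z] by linarith
  then show ?thesis
    by (intro measure_pmf.integrable_const_bound[where B = "\<bar>f (x 0 0 True)\<bar> + B"]) auto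
qed

lemma wasserstein_config_measures_ge:
  fixes f :: "'a \<Rightarrow> real"
  assumes lip: "\<And>a b. \<bar>f a - f b\<bar> \<le> dist a b"
  shows "\<bar>(\<integral>z. f (sel w z) \<partial>level_pmf N) - (\<integral>z. f (sel w' z) \<partial>level_pmf N)\<bar>
    \<le> wasserstein_dist p X (config_measure w) (config_measure w')"
proof -
  have "f \<in> borel_measurable (restrict_space borel X)"
    using lip by (rule lipschitz_borel_measurable)
  then have "(\<integral>a. f a \<partial>config_measure w) = (\<integral>z. f (sel w z) \<partial>level_pmf N)" for w
    by (simp add: config_measure_def integral_distr[OF sel_measurable])
  then show ?thesis
    using wasserstein_dist_ge[OF bounded_X p_ge_1 coupling_config_measures lip, of w w'] by simp
qed

text \<open>The test function is the distance to the points which \<open>w\<close> selects at level \<open>k\<close>.\<close>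

lemma level_separation:
  assumes "\<And>l. l \<noteq> k \<Longrightarrow> w l = w' l"
  obtains f :: "'a \<Rightarrow> real" where "\<And>a b. \<bar>f a - f b\<bar> \<le> dist a b"
    "(1 / 2) ^ Suc k * \<epsilon> k * real (card {j. j < N k \<and> (j \<in> w k) \<noteq> (j \<in> w' k)}) / real (N k)
      \<le> (\<integral>z. f (sel w' z) \<partial>level_pmf N) - (\<integral>z. f (sel w z) \<partial>level_pmf N)"
proof -
  define S where "S = (\<lambda>j. sel w (k, j)) ` {..<N k}"
  define f where "f a = infdist a S" for a
  have lip: "\<bar>f a - f b\<bar> \<le> dist a b" for a b
    unfolding f_def by (rule infdist_triangle_abs)
  let ?D = "{j. j < N k \<and> (j \<in> w k) \<noteq> (j \<in> w' k)}"
  have "(\<integral>z. f (sel w' z) \<partial>level_pmf N) - (\<integral>z. f (sel w z) \<partial>level_pmf N)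
      = (\<integral>z. f (sel w' z) - f (sel w z) \<partial>level_pmf N)"
    using lip by (intro Bochner_Integration.integral_diff[symmetric] integrable_sel)
  \<comment> \<open>The configurations agree off level \<open>k\<close>, so the integrand vanishes
    there and a finite sum remains.\<close>
  also have "\<dots> = (\<Sum>z\<in>Pair k ` {..<N k}. (f (sel w' z) - f (sel w z)) * pmf (level_pmf N) z)"
  proof (rule integral_measure_pmf_real)
    fix z assume z: "z \<in> set_pmf (level_pmf N)" and *: "f (sel w' z) - f (sel w z) \<noteq> 0"
    have "fst z = k"
    proof (rule ccontr)
      assume "fst z \<noteq> k"
      then have "w (fst z) = w' (fst z)"
        by (rule assms)
      with * show False
        by (simp add: sel_def)
    qed
    then show "z \<in> Pair k ` {..<N k}"
      using z N_pos by (auto simp: set_level_pmf)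
  qed simp
  also have "\<dots> = (\<Sum>j<N k. (f (sel w' (k, j)) - f (sel w (k, j))) * ((1 / 2) ^ Suc k / real (N k)))"
    using N_pos by (subst sum.reindex) (auto simp: inj_on_def pmf_level_pmf)
  also have "\<dots> \<ge> (\<Sum>j<N k. (if j \<in> ?D then \<epsilon> k else 0) * ((1 / 2) ^ Suc k / real (N k)))"
  proof (intro sum_mono mult_right_mono)
    fix j assume j: "j \<in> {..<N k}"
    have "f (sel w (k, j)) = 0"
      using j by (simp add: f_def S_def)
    moreover have "\<epsilon> k \<le> f (sel w' (k, j))" if "j \<in> ?D"
    proof -
      have "S \<noteq> {}"
        using N_pos[of k] by (auto simp: S_def)
      moreover have "\<epsilon> k \<le> dist (sel w' (k, j)) a" if "a \<in> S" for a
      proof -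
        obtain i where i: "i < N k" "a = sel w (k, i)"
          using \<open>a \<in> S\<close> by (auto simp: S_def)
        \<comment> \<open>For \<open>i = j\<close> the choices differ because \<open>j\<close> lies
          in \<open>?D\<close>; otherwise the indices differ.\<close>
        have "(j, j \<in> w' k) \<noteq> (i, i \<in> w k)"
          using \<open>j \<in> ?D\<close> by auto
        then show ?thesis
          using i j sep[of j k i] by (simp add: sel_def)
      qed
      ultimately show ?thesis
        unfolding f_def by (simp add: infdist_notempty cINF_greatest)
    qed
    moreover have "0 \<le> f (sel w' (k, j))"
      by (simp add: f_def infdist_nonneg)
    ultimately show "(if j \<in> ?D then \<epsilon> k else 0) \<le> f (sel w' (k, j)) - f (sel w (k, j))"
      by simp
  qed simp
  also have "(\<Sum>j<N k. (if j \<in> ?D then \<epsilon> k else 0) * ((1 / 2) ^ Suc k / real (N k)))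
      = (\<Sum>j\<in>?D. \<epsilon> k * ((1 / 2) ^ Suc k / real (N k)))"
    by (rule sum.mono_neutral_cong_right) auto
  also have "\<dots> = (1 / 2) ^ Suc k * \<epsilon> k * real (card ?D) / real (N k)"
    by simp
  finally show ?thesis
    using lip by (rule that[rotated])
qed

text \<open>The selected points can differ only on the tail event, and there by at most
  \<open>D\<close>. This allows configurations to be truncated to their first \<open>K\<close>
  levels.\<close>

lemma integral_sel_diff_le:
  fixes f :: "'a \<Rightarrow> real"
  assumes lip: "\<And>a b. \<bar>f a - f b\<bar> \<le> dist a b" and D: "\<And>a b. a \<in> X \<Longrightarrow> b \<in> X \<Longrightarrow> dist a b \<le> D"
    and eq: "\<And>j. j < K \<Longrightarrow> w j = w' j"
  shows "\<bar>(\<integral>z. f (sel w z) \<partial>level_pmf N) - (\<integral>z. f (sel w' z) \<partial>level_pmf N)\<bar>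
    \<le> D * measure_pmf.prob (level_pmf N) {z. K \<le> fst z}"
proof -
  have "\<bar>(\<integral>z. f (sel w z) \<partial>level_pmf N) - (\<integral>z. f (sel w' z) \<partial>level_pmf N)\<bar>
      = \<bar>\<integral>z. f (sel w z) - f (sel w' z) \<partial>level_pmf N\<bar>"
    using lip by (subst Bochner_Integration.integral_diff) (auto intro: integrable_sel)
  also have "\<dots> \<le> (\<integral>z. \<bar>f (sel w z) - f (sel w' z)\<bar> \<partial>level_pmf N)"
    by (rule integral_abs_bound)
  also have "\<dots> \<le> (\<integral>z. D * indicator {z. K \<le> fst z} z \<partial>level_pmf N)"
  proof (rule integral_mono)
    show "integrable (measure_pmf (level_pmf N)) (\<lambda>z. \<bar>f (sel w z) - f (sel w' z)\<bar>)"
      using lip by (intro integrable_abs Bochner_Integration.integrable_diff integrable_sel)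
    fix z
    have "\<bar>f (sel w z) - f (sel w' z)\<bar> \<le> D"
      using lip D sel_in by (meson order_trans)
    moreover have "f (sel w z) = f (sel w' z)" if "fst z < K"
      using eq[OF that] by (simp add: sel_def)
    ultimately show "\<bar>f (sel w z) - f (sel w' z)\<bar> \<le> D * indicator {z. K \<le> fst z} z"
      by (simp add: indicator_def)
  next
    show "integrable (measure_pmf (level_pmf N)) (\<lambda>z. D * indicator {z. K \<le> fst z} z)"
      by (intro measure_pmf.integrable_const_bound[where B = "\<bar>D\<bar>"]) (auto simp: indicator_def)
  qed
  also have "\<dots> = D * measure_pmf.prob (level_pmf N) {z. K \<le> fst z}"
    by simp
  finally show ?thesis .
qed

text \<open>Two values admissible for the same \<open>w\<close> can differ in at most a quarter of
  the places, by level separation. Symmetric difference with one fixed value therefore embeds the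
  admissible values into the small subsets counted by the Chernoff bound.\<close>

lemma card_level_values_le:
  assumes E: "\<And>\<mu> \<nu>. \<mu> \<in> E \<Longrightarrow> \<nu> \<in> E \<Longrightarrow> wasserstein_dist p X \<mu> \<nu> \<le> r"
    and r: "0 < r" "r \<le> (1 / 2) ^ Suc k * \<epsilon> k / 8"
  obtains K where "\<And>w. real (card {b \<in> Pow {..<N k}.
      \<exists>w'. config_measure w' \<in> E \<and> (\<forall>j<K. (w(k := b)) j = w' j)})
    \<le> exp (- real (N k) / 10) * real (card (Pow {..<N k}))"
proof -
  obtain D\<^sub>0 where D\<^sub>0: "\<forall>a\<in>X. \<forall>b\<in>X. dist a b \<le> D\<^sub>0"
    using bounded_X by (auto simp: bounded_two_points)
  define D where "D = max 1 D\<^sub>0"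
  have D: "0 < D" "\<And>a b. a \<in> X \<Longrightarrow> b \<in> X \<Longrightarrow> dist a b \<le> D"
    using D\<^sub>0 by (auto simp: D_def max.coboundedI2)
  \<comment> \<open>Each of two truncations will cost at most \<open>r / 2\<close>. Adding
    \<open>r\<close> for the distance inside \<open>E\<close> gives \<open>2 * r\<close>, at most a
    quarter of \<open>(1 / 2) ^ Suc k * \<epsilon> k\<close>; this explains the 8 in the bound on
    \<open>r\<close>.\<close>
  obtain K where K: "measure_pmf.prob (level_pmf N) {z. K \<le> fst z} < r / (2 * D)"
    using level_pmf_tail[of "r / (2 * D)" N] r D(1) by auto
  let ?\<mu> = "config_measure"
  define G where "G w = {b \<in> Pow {..<N k}. \<exists>w'. ?\<mu> w' \<in> E \<and> (\<forall>j<K. (w(k := b)) j = w' j)}" for w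
  have close: "4 * card (sym_diff b b') \<le> N k" if bb': "b \<in> G w" "b' \<in> G w" for w b b'
  proof -
    obtain v v' where v: "?\<mu> v \<in> E" "\<And>j. j < K \<Longrightarrow> (w(k := b)) j = v j"
      and v': "?\<mu> v' \<in> E" "\<And>j. j < K \<Longrightarrow> (w(k := b')) j = v' j"
      using bb' by (auto simp: G_def)
    have sub: "b \<subseteq> {..<N k}" "b' \<subseteq> {..<N k}"
      using bb' by (auto simp: G_def)
    let ?u = "w(k := b)" and ?u' = "w(k := b')"
    let ?a = "(1 / 2) ^ Suc k * \<epsilon> k"
    let ?I = "\<lambda>f w. \<integral>z. f (sel w z) \<partial>level_pmf N"
    obtain f where lip: "\<And>a b :: 'a. \<bar>f a - f b\<bar> \<le> dist a b" and
      f: "?a * real (card {j. j < N k \<and> (j \<in> ?u k) \<noteq> (j \<in> ?u' k)}) / real (N k) \<le> ?I f ?u' - ?I f ?u"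
      by (rule level_separation[of k ?u ?u']) auto
    have "\<bar>?I f ?u - ?I f v\<bar> \<le> D * measure_pmf.prob (level_pmf N) {z. K \<le> fst z}"
      using lip D(2) v(2) by (rule integral_sel_diff_le)
    moreover have "\<bar>?I f ?u' - ?I f v'\<bar> \<le> D * measure_pmf.prob (level_pmf N) {z. K \<le> fst z}"
      using lip D(2) v'(2) by (rule integral_sel_diff_le)
    moreover have "D * measure_pmf.prob (level_pmf N) {z. K \<le> fst z} \<le> r / 2"
      using K D(1) by (simp add: field_simps)
    moreover have "\<bar>?I f v - ?I f v'\<bar> \<le> r"
      using wasserstein_config_measures_ge[OF lip] E[OF v(1) v'(1)] by (rule order_trans)
    ultimately have "?I f ?u' - ?I f ?u \<le> 2 * r"
      by linarith
    moreover have sym_diff: "{j. j < N k \<and> (j \<in> ?u k) \<noteq> (j \<in> ?u' k)} = sym_diff b b'"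
      using sub by auto
    ultimately have "?a * (real (card (sym_diff b b')) / real (N k)) \<le> ?a * (1 / 4)"
      using f[unfolded sym_diff] r(2) by (simp only: times_divide_eq_right)
    then have "real (card (sym_diff b b')) / real (N k) \<le> 1 / 4"
      using eps_pos[of k] by (subst (asm) mult_le_cancel_left_pos) auto
    then show ?thesis
      using N_pos[of k] by (simp add: field_simps)
  qed
  have "real (card (G w)) \<le> exp (- real (N k) / 10) * real (card (Pow {..<N k}))" for w
  proof (cases "G w = {}")
    case False
    then obtain b0 where b0: "b0 \<in> G w"
      by blast
    have "card (G w) \<le> card {c \<in> Pow {..<N k}. 4 * card c \<le> N k}"
    proof (rule card_inj_on_le)
      show "inj_on (sym_diff b0) (G w)"
        by (rule inj_onI) blast
      show "sym_diff b0 ` G w \<subseteq> {c \<in> Pow {..<N k}. 4 * card c \<le> N k}"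
      proof (rule image_subsetI)
        fix b assume b: "b \<in> G w"
        then have "sym_diff b0 b \<subseteq> {..<N k}"
          using b0 by (auto simp: G_def)
        with close[OF b0 b] show "sym_diff b0 b \<in> {c \<in> Pow {..<N k}. 4 * card c \<le> N k}"
          by simp
      qed
    qed simp
    then have "real (card (G w)) \<le> real (card {c \<in> Pow {..<N k}. 4 * card c \<le> N k})"
      by simp
    also note card_small_subsets_le
    finally show ?thesis
      by (simp add: card_Pow)
  qed simp
  then show ?thesis
    unfolding G_def by (rule that)
qed

end

section \<open>The critical parameter\<close>

lemma divide_power_powr_minus:
  fixes a x t :: real
  assumes "0 < x"
  shows "(a / x ^ k) powr - t = a powr - t * (x powr t) ^ k"
proof -
  have "(a / x ^ k) powr - t = a powr - t / (x ^ k) powr - t"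
    by (rule powr_divide)
  also have "(x ^ k) powr - t = inverse ((x ^ k) powr t)"
    by (rule powr_minus)
  also have "(x ^ k) powr t = (x powr t) ^ k"
    using assms by (simp add: powr_realpow[symmetric] powr_powr mult.commute)
  finally show ?thesis
    by (simp only: divide_inverse inverse_inverse_eq)
qed

text \<open>With \<open>u = 2 powr (2 * t / (s - t))\<close> one has \<open>u powr s = 2 powr t * (2 * u) powr t\<close>, so that
  \<open>N k \<ge> c * (\<epsilon>\<^sub>0 / u ^ k) powr - s\<close> beats \<open>r powr - t\<close> although the weight \<open>(1 / 2) ^ Suc k\<close> of level
  \<open>k\<close> reduces its scale to \<open>(2 * u) powr - k\<close>.\<close>

lemma exists_good_level:
  fixes s t c \<epsilon>\<^sub>0 :: real
  assumes "0 < t" "t < s" "0 < c" "0 < \<epsilon>\<^sub>0" and u_def: "u = 2 powr (2 * t / (s - t))"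
  obtains r\<^sub>0 where "0 < r\<^sub>0" "\<And>r. 0 < r \<Longrightarrow> r \<le> r\<^sub>0 \<Longrightarrow>
    \<exists>k. r \<le> (1 / 2) ^ Suc k * (\<epsilon>\<^sub>0 / u ^ k) / 8 \<and> 10 * r powr - t \<le> c * (\<epsilon>\<^sub>0 / u ^ k) powr - s"
proof -
  have u: "1 \<le> u"
    unfolding u_def using assms by (intro ge_one_powr_ge_zero) auto
  \<comment> \<open>\<open>g k\<close> is the largest diameter that level \<open>k\<close> can
    handle; 16 is the 8 times the extra 2 in \<open>2 ^ Suc k\<close>.\<close>
  define g where "g k = \<epsilon>\<^sub>0 / 16 / (2 * u) ^ k" for k
  have g_pos: "0 < g k" for k
    using u assms by (simp add: g_def)
  have g_eq: "(1 / 2) ^ Suc k * (\<epsilon>\<^sub>0 / u ^ k) / 8 = g k" for k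
    by (simp add: g_def power_mult_distrib power_one_over field_simps)
  have g_antimono: "g k \<le> g j" if "j \<le> k" for j k
    unfolding g_def using u assms that
    by (intro divide_left_mono power_increasing mult_pos_pos zero_less_power) auto
  have g_powr: "g k powr - t = (\<epsilon>\<^sub>0 / 16) powr - t * ((2 * u) powr t) ^ k" for k
    unfolding g_def using u by (intro divide_power_powr_minus) auto
  have eps_powr: "(\<epsilon>\<^sub>0 / u ^ k) powr - s = \<epsilon>\<^sub>0 powr - s * (u powr s) ^ k" for k
    using u by (intro divide_power_powr_minus) auto
  have u_powr: "u powr s = 2 powr t * (2 * u) powr t"
  proof -
    have "2 * t / (s - t) * s = t + (t + 2 * t / (s - t) * t)"
      using assms by (simp add: field_simps)
    then show ?thesis
      using u by (simp add: u_def powr_powr powr_mult flip: powr_add)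
  qed
  \<comment> \<open>\<open>C\<close> collects the factors independent of \<open>k\<close>, including
    one \<open>(2 * u) powr t\<close> from the shift to \<open>Suc k\<close>; what remains is
    \<open>C \<le> (2 powr t) ^ k\<close>.\<close>
  define C where "C = 10 * (\<epsilon>\<^sub>0 / 16) powr - t * (2 * u) powr t / (c * \<epsilon>\<^sub>0 powr - s)"
  have "1 < (2 :: real) powr t"
    using assms by (simp add: gr_one_powr)
  then obtain k\<^sub>0 where k\<^sub>0: "C < (2 powr t) ^ k\<^sub>0"
    using real_arch_pow by blast
  have late: "10 * g (Suc k) powr - t \<le> c * (\<epsilon>\<^sub>0 / u ^ k) powr - s" if "k\<^sub>0 \<le> k" for k
  proof -
    have "C \<le> (2 powr t) ^ k"
      using k\<^sub>0 power_increasing[OF that less_imp_le[OF \<open>1 < 2 powr t\<close>]] by linarith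
    then have "10 * (\<epsilon>\<^sub>0 / 16) powr - t * (2 * u) powr t \<le> (2 powr t) ^ k * (c * \<epsilon>\<^sub>0 powr - s)"
      unfolding C_def using assms by (subst (asm) pos_divide_le_eq) auto
    then have "10 * (\<epsilon>\<^sub>0 / 16) powr - t * (2 * u) powr t * ((2 * u) powr t) ^ k
        \<le> (2 powr t) ^ k * (c * \<epsilon>\<^sub>0 powr - s) * ((2 * u) powr t) ^ k"
      by (rule mult_right_mono) simp
    then show ?thesis
      by (simp add: g_powr eps_powr u_powr power_mult_distrib mult_ac)
  qed
  have "\<exists>k. r \<le> (1 / 2) ^ Suc k * (\<epsilon>\<^sub>0 / u ^ k) / 8 \<and> 10 * r powr - t \<le> c * (\<epsilon>\<^sub>0 / u ^ k) powr - s"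
    if r: "0 < r" "r \<le> g k\<^sub>0" for r
  proof -
    have "1 < 2 * u"
      using u by simp
    then obtain n where "\<epsilon>\<^sub>0 / 16 / r < (2 * u) ^ n"
      using real_arch_pow by blast
    then have "g n < r"
      using u r by (simp add: g_def field_simps)
    \<comment> \<open>The first scale below \<open>r\<close>: level \<open>l - 1\<close> still
      admits \<open>r\<close>, while \<open>g l < r\<close> bounds
      \<open>r powr - t\<close>.\<close>
    define l where "l = (LEAST n. g n < r)"
    have l: "g l < r" "\<And>j. j < l \<Longrightarrow> r \<le> g j"
      unfolding l_def using \<open>g n < r\<close> by (auto intro: LeastI dest: not_less_Least)
    have "k\<^sub>0 < l"
      using l(1) r(2) g_antimono[of l k\<^sub>0] by (meson leI less_le_trans not_less)
    then obtain k where k: "l = Suc k" "k\<^sub>0 \<le> k"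
      by (cases l) auto
    have "r powr - t \<le> g (Suc k) powr - t"
      using l(1) k(1) g_pos assms(1) by (intro powr_mono2') auto
    then have "10 * r powr - t \<le> c * (\<epsilon>\<^sub>0 / u ^ k) powr - s"
      using late[OF k(2)] by linarith
    moreover have "r \<le> (1 / 2) ^ Suc k * (\<epsilon>\<^sub>0 / u ^ k) / 8"
      unfolding g_eq using l(2)[of k] k(1) by simp
    ultimately show ?thesis
      by blast
  qed
  with g_pos show ?thesis
    by (rule that)
qed

text \<open>Cover members of diameter 0 have gauge 0, but the level argument needs a positive
  radius. A tiny radius is used for them, and its gauge is charged to \<open>\<eta>\<close>.\<close>

lemma exists_gauge_radius:
  assumes "0 < t" "0 \<le> d" "d \<le> r\<^sub>0" "0 < r\<^sub>0" "0 < \<eta>"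
  obtains r where "0 < r" "r \<le> r\<^sub>0" "d \<le> r" "exp (- (r powr - t)) \<le> pow_exp_gauge t d + \<eta>"
proof (cases "d = 0")
  case False
  then show ?thesis
    using assms by (intro that[of d]) (auto simp: pow_exp_gauge_def powr_minus_divide)
next
  case True
  define r where "r = min r\<^sub>0 (\<eta> powr (1 / t))"
  have r: "0 < r" "r \<le> r\<^sub>0"
    using assms by (auto simp: r_def)
  have "r powr t \<le> (\<eta> powr (1 / t)) powr t"
    using r assms by (intro powr_mono2) (auto simp: r_def)
  also have "\<dots> = \<eta>"
    using assms by (simp add: powr_powr)
  finally have "r powr t \<le> \<eta>" .
  \<comment> \<open>This is \<open>exp (- y) \<le> 1 / y\<close> for
    \<open>y = r powr - t\<close>.\<close>
  have "r powr - t \<le> exp (r powr - t)"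
    using exp_ge_add_one_self[of "r powr - t"] by linarith
  then have "exp (- (r powr - t)) \<le> r powr t"
    using r by (simp add: exp_minus powr_minus field_simps)
  then show ?thesis
    using r \<open>r powr t \<le> \<eta>\<close> True by (intro that[of r]) (auto simp: pow_exp_gauge_def)
qed

text \<open>Each member of a fine cover is assigned a level suited to its diameter, where it
  captures at most a proportion \<open>q i\<close> of the choices. The union bound then makes
  finitely many \<open>q i\<close> sum to at least 1.\<close>

lemma gauge_measure_wasserstein_pos:
  fixes X :: "'a::metric_space set"
  assumes "compact X" "1 \<le> p" "0 < t" "t < s" "0 < gauge_measure (power_gauge s) X dist"
  shows "0 < gauge_measure (pow_exp_gauge t) (borel_probs X) (wasserstein_dist p X)"
proof -
  let ?W = "wasserstein_dist p X"
  obtain c \<epsilon>\<^sub>0 :: real where c: "0 < c" and \<epsilon>\<^sub>0: "0 < \<epsilon>\<^sub>0"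
    and pairs: "\<And>\<epsilon>. 0 < \<epsilon> \<Longrightarrow> \<epsilon> \<le> \<epsilon>\<^sub>0 \<Longrightarrow> \<exists>N (x :: nat \<Rightarrow> bool \<Rightarrow> 'a). 0 < N \<and> c * \<epsilon> powr - s \<le> real N \<and>
      (\<forall>j b. x j b \<in> X) \<and>
      (\<forall>j<N. \<forall>j'<N. \<forall>b b'. (j, b) \<noteq> (j', b') \<longrightarrow> \<epsilon> \<le> dist (x j b) (x j' b'))"
    by (rule separated_pairs_of_gauge_measure_pos[OF assms(1) order.strict_trans[OF assms(3,4)] assms(5)])
      (rule that)
  define u where "u = (2 :: real) powr (2 * t / (s - t))"
  define \<epsilon> where "\<epsilon> k = \<epsilon>\<^sub>0 / u ^ k" for k
  have "1 \<le> u"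
    unfolding u_def using assms by (intro ge_one_powr_ge_zero) auto
  then have \<epsilon>: "0 < \<epsilon> k" "\<epsilon> k \<le> \<epsilon>\<^sub>0" for k
    using \<epsilon>\<^sub>0 one_le_power[of u k] by (auto simp: \<epsilon>_def field_simps)
  have "\<forall>k. \<exists>N (x :: nat \<Rightarrow> bool \<Rightarrow> 'a). 0 < N \<and> c * \<epsilon> k powr - s \<le> real N \<and>
      (\<forall>j b. x j b \<in> X) \<and>
      (\<forall>j<N. \<forall>j'<N. \<forall>b b'. (j, b) \<noteq> (j', b') \<longrightarrow> \<epsilon> k \<le> dist (x j b) (x j' b'))"
    by (intro allI pairs \<epsilon>)
  from choice[OF this] obtain N where "\<forall>k. \<exists>x :: nat \<Rightarrow> bool \<Rightarrow> 'a. 0 < N k \<and> c * \<epsilon> k powr - s \<le> real (N k) \<and>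
      (\<forall>j b. x j b \<in> X) \<and>
      (\<forall>j<N k. \<forall>j'<N k. \<forall>b b'. (j, b) \<noteq> (j', b') \<longrightarrow> \<epsilon> k \<le> dist (x j b) (x j' b'))"
    by (elim exE)
  from choice[OF this] obtain x :: "nat \<Rightarrow> nat \<Rightarrow> bool \<Rightarrow> 'a" where x: "\<forall>k. 0 < N k \<and>
      c * \<epsilon> k powr - s \<le> real (N k) \<and> (\<forall>j b. x k j b \<in> X) \<and>
      (\<forall>j<N k. \<forall>j'<N k. \<forall>b b'. (j, b) \<noteq> (j', b') \<longrightarrow> \<epsilon> k \<le> dist (x k j b) (x k j' b'))"
    by (elim exE)
  interpret separated_levels X p N x \<epsilon>
    using assms(1,2) x \<epsilon>(1) by unfold_locales (auto intro: compact_imp_bounded)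
  obtain r\<^sub>0 where r\<^sub>0: "0 < r\<^sub>0" and good: "\<And>r. 0 < r \<Longrightarrow> r \<le> r\<^sub>0 \<Longrightarrow>
    \<exists>k. r \<le> (1 / 2) ^ Suc k * (\<epsilon>\<^sub>0 / u ^ k) / 8 \<and> 10 * r powr - t \<le> c * (\<epsilon>\<^sub>0 / u ^ k) powr - s"
    by (rule exists_good_level[OF assms(3,4) c \<epsilon>\<^sub>0 u_def]) (rule that)
  have "ennreal (1 / 2) \<le> gauge_content (pow_exp_gauge t) (borel_probs X) ?W r\<^sub>0"
    unfolding gauge_content_def
  proof (rule INF_greatest)
    fix E assume E: "E \<in> delta_covers (borel_probs X) ?W r\<^sub>0"
    define d where "d i = enn2real (ediam ?W (E i))" for i
    have diam: "ediam ?W (E i) \<le> ennreal r\<^sub>0" for i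
      using E by (auto simp: delta_covers_def)
    have d: "0 \<le> d i" "d i \<le> r\<^sub>0" for i
      using enn2real_mono[OF diam, of i] r\<^sub>0 by (auto simp: d_def)
    have W_le: "?W \<mu> \<nu> \<le> d i" if "\<mu> \<in> E i" "\<nu> \<in> E i" for \<mu> \<nu> i
    proof -
      have "ennreal (?W \<mu> \<nu>) \<le> ediam ?W (E i)"
        unfolding ediam_def using that by (intro SUP_upper2[of "(\<mu>, \<nu>)"]) auto
      then have "enn2real (ennreal (?W \<mu> \<nu>)) \<le> d i"
        unfolding d_def using diam[of i] by (intro enn2real_mono) (auto intro: le_less_trans)
      then show ?thesis
        by (simp add: wasserstein_dist_def)
    qed
    \<comment> \<open>The tolerances \<open>(1 / 2) ^ (i + 2)\<close> sum to 1/2, which leaves at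
      least 1/2 for the gauges.\<close>
    define q where "q i = pow_exp_gauge t (d i) + (1 / 2) ^ (i + 2)" for i
    \<comment> \<open>The sets \<open>E i\<close> are arbitrary, so the configurations landing in
      them are enlarged to cylinders in order to use compactness.\<close>
    let ?U = "\<lambda>K i. {w. \<exists>w'. config_measure w' \<in> E i \<and> (\<forall>j<K. w j = w' j)}"
    have "\<forall>i. \<exists>k K. \<forall>w. real (card {b \<in> Pow {..<N k}. w(k := b) \<in> ?U K i}) \<le> q i * real (card (Pow {..<N k}))"
    proof
      fix i
      obtain r where r: "0 < r" "r \<le> r\<^sub>0" "d i \<le> r" "exp (- (r powr - t)) \<le> q i"
        unfolding q_def using exists_gauge_radius[OF assms(3) d r\<^sub>0, of "(1 / 2) ^ (i + 2)" i] by auto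
      obtain k where k: "r \<le> (1 / 2) ^ Suc k * \<epsilon> k / 8" "10 * r powr - t \<le> c * \<epsilon> k powr - s"
        using good[OF r(1,2), folded \<epsilon>_def] by blast
      obtain K where K: "\<And>w. real (card {b \<in> Pow {..<N k}.
          \<exists>w'. config_measure w' \<in> E i \<and> (\<forall>j<K. (w(k := b)) j = w' j)})
        \<le> exp (- real (N k) / 10) * real (card (Pow {..<N k}))"
        using card_level_values_le[OF order_trans[OF W_le r(3)] r(1) k(1)] by blast
      have "c * \<epsilon> k powr - s \<le> real (N k)"
        using x by blast
      with k(2) have "10 * r powr - t \<le> real (N k)"
        by (rule order_trans)
      \<comment> \<open>The factor 10 in the choice of level absorbs the 10 of the Chernoff
        bound.\<close>
      then have "exp (- real (N k) / 10) \<le> exp (- (r powr - t))"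
        by simp
      then have "exp (- real (N k) / 10) \<le> q i"
        using r(4) by (rule order_trans)
      then have "exp (- real (N k) / 10) * real (card (Pow {..<N k})) \<le> q i * real (card (Pow {..<N k}))"
        by (rule mult_right_mono) simp
      then show "\<exists>k K. \<forall>w. real (card {b \<in> Pow {..<N k}. w(k := b) \<in> ?U K i}) \<le> q i * real (card (Pow {..<N k}))"
        using order_trans[OF K] by (intro exI[of _ k] exI[of _ K]) auto
    qed
    from choice[OF this] obtain k where "\<forall>i. \<exists>K. \<forall>w. real (card {b \<in> Pow {..<N (k i)}. w(k i := b) \<in> ?U K i})
        \<le> q i * real (card (Pow {..<N (k i)}))"
      by (elim exE)
    from choice[OF this] obtain K where kK: "\<forall>i w. real (card {b \<in> Pow {..<N (k i)}. w(k i := b) \<in> ?U (K i) i})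
        \<le> q i * real (card (Pow {..<N (k i)}))"
      by (elim exE)
    obtain F where F: "finite F" "1 \<le> (\<Sum>i\<in>F. q i)"
    proof (rule cylinder_cover_weight_ge_1[of "\<lambda>k. Pow {..<N k}" "\<lambda>i. ?U (K i) i" K k q])
      show "(\<Pi>\<^sub>E k\<in>UNIV. Pow {..<N k}) \<subseteq> (\<Union>i. ?U (K i) i)"
      proof
        fix w
        have "borel_probs X \<subseteq> (\<Union>i. E i)"
          using E by (simp add: delta_covers_def)
        then obtain i where "config_measure w \<in> E i"
          using config_measure_in[of w] by blast
        then show "w \<in> (\<Union>i. ?U (K i) i)"
          by auto
      qed
    qed (use kK in auto)
    have sums: "(\<lambda>i. (1 / 2 :: real) ^ (i + 2)) sums (1 / 2)"
      using sums_mult[OF geometric_sums[of "1 / 2 :: real"], of "1 / 4"] by simp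
    have "(\<Sum>i\<in>F. (1 / 2 :: real) ^ (i + 2)) \<le> (\<Sum>i. (1 / 2) ^ (i + 2))"
      using F(1) sums_summable[OF sums] by (intro sum_le_suminf) auto
    also have "\<dots> = 1 / 2"
      using sums by (rule sums_unique[symmetric])
    finally have "1 / 2 \<le> (\<Sum>i\<in>F. pow_exp_gauge t (d i))"
      using F(2) by (simp add: q_def sum.distrib)
    then have "ennreal (1 / 2) \<le> ennreal (\<Sum>i\<in>F. pow_exp_gauge t (d i))"
      by (rule ennreal_leI)
    also have "\<dots> = (\<Sum>i\<in>F. ennreal (pow_exp_gauge t (d i)))"
      by (rule sum_ennreal[symmetric]) (simp add: pow_exp_gauge_def)
    also have "\<dots> \<le> (\<Sum>i. ennreal (pow_exp_gauge t (d i)))"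
      using F(1) by (intro sum_le_suminf) auto
    finally show "ennreal (1 / 2) \<le> (\<Sum>i. ennreal (pow_exp_gauge t (enn2real (ediam ?W (E i)))))"
      by (simp add: d_def)
  qed
  also have "\<dots> \<le> gauge_measure (pow_exp_gauge t) (borel_probs X) ?W"
    unfolding gauge_measure_eq_SUP using r\<^sub>0 by (intro SUP_upper) simp
  finally show ?thesis
    by (rule less_le_trans[rotated]) (simp only: ennreal_less_zero_iff)
qed

theorem theorem1p3:
  fixes X :: "'a::metric_space set" and p :: real
  assumes "compact X" and "1 \<le> p"
  shows "crit_pow_exp (borel_probs X) (wasserstein_dist p X) \<ge> hausdorff_dim X dist"
  unfolding hausdorff_dim_def crit_pow_exp_def crit_param_def
proof (rule Sup_least)
  fix a assume "a \<in> {ennreal s | s. s > 0 \<and> gauge_measure (power_gauge s) X dist > 0}"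
  then obtain s where s: "a = ennreal s" "0 < s" "0 < gauge_measure (power_gauge s) X dist"
    by blast
  let ?T = "{ennreal t | t. t > 0 \<and> gauge_measure (pow_exp_gauge t) (borel_probs X) (wasserstein_dist p X) > 0}"
  show "a \<le> Sup ?T"
  \<comment> \<open>The comparison needs a strict gap \<open>t < s\<close>, so \<open>s\<close> is
    approached from below.\<close>
  proof (rule dense_le)
    fix b assume "b < a"
    then obtain t where t: "b = ennreal t" "0 \<le> t" "t < s"
      using s(1) by (cases b) (auto simp: ennreal_less_iff)
    show "b \<le> Sup ?T"
    proof (cases "t = 0")
      case False
      then have "b \<in> ?T"
        using t s gauge_measure_wasserstein_pos[OF assms, of t s] by auto
      then show ?thesis
        by (rule Sup_upper)
    qed (use t in simp)
  qed
qed

end
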